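(* Let $\Omega\subset\mathbb{R}^d$ be compact. For any $\rho\in\mathcal{P}(\Omega)$, the map $T\mapsto\mathcal{M}^2_\rho(T)$ is convex on continuous vector fields $T:\Omega\to\Omega$; that is, for all continuous $T_0,T_1:\Omega\to\Omega$ and $t\in[0,1]$ such that $(1-t)T_0+tT_1$ takes values in $\Omega$, $$\mathcal{M}^2_\rho\big((1-t)T_0+tT_1\big)\le(1-t)\,\mathcal{M}^2_\rho(T_0)+t\,\mathcal{M}^2_\rho(T_1).$$
   Context: $\mathcal{P}(\Omega)$ is the set of Borel probability measures on $\Omega$, and $T\sharp\rho$ is the push-forward of $\rho$ by $T$. $\mathcal{M}^2_\rho$ is the Monge gap for the squared Euclidean cost $c(\mathbf{x},\mathbf{y})=\|\mathbf{x}-\mathbf{y}\|_2^2$: $$\mathcal{M}^2_\rho(T)=\int_\Omega\|\mathbf{x}-T(\mathbf{x})\|_2^2\,d\rho(\mathbf{x})-W_c(\rho,T\sharp\rho),$$ where, for $\alpha,\beta\in\mathcal{P}(\Omega)$, $$W_c(\alpha,\beta)=\min_{\pi\in\Pi(\alpha,\beta)}\iint_{\Omega\times\Omega}\|\mathbf{x}-\mathbf{y}\|_2^2\,d\pi(\mathbf{x},\mathbf{y})$$ and $\Pi(\alpha,\beta)$ is the set of probability measures on $\Omega\times\Omega$ with marginals $\alpha$ and $\beta$. *)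

theory Defs
  imports "HOL-Probability.Probability"
begin

definition borel_probs :: "'a::topological_space set \<Rightarrow> 'a measure set" where
  "borel_probs \<Omega> = {\<mu>. prob_space \<mu> \<and> sets \<mu> = sets (restrict_space borel \<Omega>)}"

text \<open>The push-forward is \<^const>\<open>distr\<close>. Its target is the Borel space of \<open>\<Omega>\<close> rather than of the
  ambient space, so that the push-forward of a measure on \<open>\<Omega>\<close> is again a measure on \<open>\<Omega>\<close>.\<close>

definition push_forward :: "'b::topological_space set \<Rightarrow> ('a \<Rightarrow> 'b) \<Rightarrow> 'a measure \<Rightarrow> 'b measure" where
  "push_forward \<Omega> T \<mu> = distr \<mu> (restrict_space borel \<Omega>) T"

definition couplings :: "'a::topological_space set \<Rightarrow> 'a measure \<Rightarrow> 'a measure \<Rightarrow> ('a \<times> 'a) measure set" where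
  "couplings \<Omega> \<alpha> \<beta> =
     {\<pi> \<in> borel_probs (\<Omega> \<times> \<Omega>). push_forward \<Omega> fst \<pi> = \<alpha> \<and> push_forward \<Omega> snd \<pi> = \<beta>}"

text \<open>The minimum of the Kantorovich problem is written as an infimum. For compact \<open>\<Omega>\<close> and
  \<open>\<alpha>\<close>, \<open>\<beta>\<close> in \<^term>\<open>borel_probs \<Omega>\<close> the set of values is nonempty (product coupling) and bounded
  below by 0, the integrand is bounded and measurable, and the infimum is attained, so this is
  the minimum.\<close>

definition W2_cost :: "'a::euclidean_space set \<Rightarrow> 'a measure \<Rightarrow> 'a measure \<Rightarrow> real" where
  "W2_cost \<Omega> \<alpha> \<beta> =
     (INF \<pi> \<in> couplings \<Omega> \<alpha> \<beta>. \<integral>z. (norm (fst z - snd z))\<^sup>2 \<partial>\<pi>)"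

definition monge_gap :: "'a::euclidean_space set \<Rightarrow> 'a measure \<Rightarrow> ('a \<Rightarrow> 'a) \<Rightarrow> real" where
  "monge_gap \<Omega> \<rho> T =
     (\<integral>x. (norm (x - T x))\<^sup>2 \<partial>\<rho>) - W2_cost \<Omega> \<rho> (push_forward \<Omega> T \<rho>)"

end

theory Submission
  imports Defs
begin

text \<open>Expanding the square shows that
  \<open>\<parallel>x - T z\<parallel>\<^sup>2 - \<parallel>z - T z\<parallel>\<^sup>2\<close> is affine in \<open>T\<close>. If the optimal
  transport cost between \<open>\<rho>\<close> and \<open>T\<sharp>\<rho>\<close> is computed over couplings \<open>\<gamma>\<close> of \<open>\<rho>\<close> with itself,
  i.e. as the infimum of \<open>\<integral> \<parallel>x - T z\<parallel>\<^sup>2 d\<gamma>(x, z)\<close>, the Monge gap therefore becomes a supremum of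
  functionals affine in \<open>T\<close>. Such a \<open>\<gamma>\<close> arises from a coupling \<open>\<pi>\<close> of \<open>\<rho>\<close> and \<open>T\<sharp>\<rho>\<close> by gluing
  \<open>\<pi>\<close> to the graph of \<open>T\<close>. Disintegration is avoided by gluing only approximately: \<open>\<Omega>\<close> is cut into
  countably many small cells, and \<open>(x, y)\<close> is joined to those \<open>z\<close> for which \<open>T z\<close> lies in the
  cell of \<open>y\<close>.\<close>

section \<open>Gluing along countably many labels\<close>

text \<open>Within each label the two measures are coupled independently: \<open>P\<close> is the
  sum over labels \<open>i\<close> of the product of M restricted to \<open>g = i\<close> and N
  restricted to \<open>h = i\<close>, divided by the mass of the label. Both marginals come out
  right because the two blocks of a label have equal mass.\<close>

lemma gluing_over_countable:
  fixes g :: "'a \<Rightarrow> 'c::countable" and h :: "'b \<Rightarrow> 'c"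
  assumes "prob_space M" "prob_space N"
    and g [measurable]: "g \<in> measurable M (count_space UNIV)"
    and h [measurable]: "h \<in> measurable N (count_space UNIV)"
    and eq: "distr M (count_space UNIV) g = distr N (count_space UNIV) h"
  obtains P where "sets P = sets (M \<Otimes>\<^sub>M N)" "distr P M fst = M" "distr P N snd = N"
    "AE p in P. g (fst p) = h (snd p)"
proof
  interpret M: prob_space M by fact
  interpret N: prob_space N by fact
  interpret MN: pair_prob_space M N ..
  define m where "m i = emeasure M {x\<in>space M. g x = i}" for i
  \<comment> \<open>In \<open>ennreal\<close> the inverse of 0 is infinite, so \<open>f\<close> is
    infinite on blocks of mass zero. Such blocks are negligible for both measures, as
    \<open>M1\<close> and \<open>N1\<close> record.\<close>
  define f where "f p = (if g (fst p) = h (snd p) then inverse (m (g (fst p))) else 0)" for p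
  define P where "P = density (M \<Otimes>\<^sub>M N) f"
  have mN: "m i = emeasure N {y\<in>space N. h y = i}" for i
  proof -
    have "m i = emeasure (distr M (count_space UNIV) g) {i}"
      by (subst emeasure_distr) (auto simp: m_def intro!: arg_cong[where f="emeasure M"])
    also have "\<dots> = emeasure N {y\<in>space N. h y = i}"
      unfolding eq by (subst emeasure_distr) (auto intro!: arg_cong[where f="emeasure N"])
    finally show ?thesis .
  qed
  have m_cancel: "inverse (m i) * m i = 1" if "m i \<noteq> 0" for i
  proof -
    have "m i \<noteq> top" by (simp add: m_def)
    with that show ?thesis
      by (metis ennreal_divide_self divide_ennreal_def mult.commute top.not_eq_extremum)
  qed
  have [measurable]: "f \<in> borel_measurable (M \<Otimes>\<^sub>M N)"
    unfolding f_def by measurable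
  \<comment> \<open>Countability of the label type enters here: the null blocks can be discarded all
    at once.\<close>
  have M1: "AE x in M. m (g x) \<noteq> 0"
  proof -
    have "AE x in M. \<forall>i. m i = 0 \<longrightarrow> g x \<noteq> i"
      unfolding AE_all_countable
    proof
      fix i
      show "AE x in M. m i = 0 \<longrightarrow> g x \<noteq> i"
        by (cases "m i = 0") (auto simp: m_def intro!: AE_I[where N="{x\<in>space M. g x = i}"])
    qed
    then show ?thesis by eventually_elim auto
  qed
  have N1: "AE y in N. m (h y) \<noteq> 0"
  proof -
    have "AE y in N. \<forall>i. m i = 0 \<longrightarrow> h y \<noteq> i"
      unfolding AE_all_countable
    proof
      fix i
      show "AE y in N. m i = 0 \<longrightarrow> h y \<noteq> i"
        by (cases "m i = 0") (auto simp: mN intro!: AE_I[where N="{x\<in>space N. h x = i}"])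
    qed
    then show ?thesis by eventually_elim auto
  qed
  \<comment> \<open>The slice of \<open>f\<close> at \<open>x\<close> is the constant
    \<open>inverse (m (g x))\<close> on a block whose N-mass is \<open>m (g x)\<close>.\<close>
  have fN: "(\<integral>\<^sup>+y. f (x, y) \<partial>N) = 1" if "x \<in> space M" "m (g x) \<noteq> 0" for x
  proof -
    have "(\<integral>\<^sup>+y. f (x, y) \<partial>N) = (\<integral>\<^sup>+y. inverse (m (g x)) * indicator {y\<in>space N. h y = g x} y \<partial>N)"
      by (intro nn_integral_cong) (auto simp: f_def split: split_indicator)
    also have "\<dots> = 1"
      using that by (simp add: nn_integral_cmult m_cancel mN[symmetric])
    finally show ?thesis .
  qed
  have fM: "(\<integral>\<^sup>+x. f (x, y) \<partial>M) = 1" if "y \<in> space N" "m (h y) \<noteq> 0" for y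
  proof -
    have "(\<integral>\<^sup>+x. f (x, y) \<partial>M) = (\<integral>\<^sup>+x. inverse (m (h y)) * indicator {x\<in>space M. g x = h y} x \<partial>M)"
      by (intro nn_integral_cong) (auto simp: f_def split: split_indicator)
    also have "\<dots> = 1"
      using that by (simp add: nn_integral_cmult m_cancel m_def[symmetric])
    finally show ?thesis .
  qed
  show sP [measurable_cong]: "sets P = sets (M \<Otimes>\<^sub>M N)" by (simp add: P_def)
  have spP: "space P = space M \<times> space N"
    using sets_eq_imp_space_eq[OF sP] by (simp add: space_pair_measure)
  show "distr P M fst = M"
  proof (rule measure_eqI)
    fix A assume "A \<in> sets (distr P M fst)"
    then have A [measurable]: "A \<in> sets M" by simp
    have "emeasure (distr P M fst) A = emeasure P (fst -` A \<inter> space P)"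
      by (rule emeasure_distr) auto
    also have "\<dots> = (\<integral>\<^sup>+p. f p * indicator (fst -` A \<inter> space P) p \<partial>(M \<Otimes>\<^sub>M N))"
      unfolding P_def by (rule emeasure_density) (auto intro!: measurable_sets[OF measurable_fst])
    also have "\<dots> = (\<integral>\<^sup>+p. f p * indicator A (fst p) \<partial>(M \<Otimes>\<^sub>M N))"
      by (intro nn_integral_cong) (auto simp: spP space_pair_measure split: split_indicator)
    also have "\<dots> = (\<integral>\<^sup>+x. \<integral>\<^sup>+y. f (x, y) * indicator A x \<partial>N \<partial>M)"
      by (subst N.nn_integral_fst[symmetric]) auto
    also have "\<dots> = (\<integral>\<^sup>+x. indicator A x \<partial>M)"
      by (intro nn_integral_cong_AE, use M1 AE_space in eventually_elim)
         (auto simp: fN nn_integral_multc split: split_indicator)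
    finally show "emeasure (distr P M fst) A = emeasure M A" by simp
  qed simp
  show "distr P N snd = N"
  proof (rule measure_eqI)
    fix A assume "A \<in> sets (distr P N snd)"
    then have A [measurable]: "A \<in> sets N" by simp
    have "emeasure (distr P N snd) A = emeasure P (snd -` A \<inter> space P)"
      by (rule emeasure_distr) auto
    also have "\<dots> = (\<integral>\<^sup>+p. f p * indicator (snd -` A \<inter> space P) p \<partial>(M \<Otimes>\<^sub>M N))"
      unfolding P_def by (rule emeasure_density) (auto intro!: measurable_sets[OF measurable_snd])
    also have "\<dots> = (\<integral>\<^sup>+p. f p * indicator A (snd p) \<partial>(M \<Otimes>\<^sub>M N))"
      by (intro nn_integral_cong) (auto simp: spP space_pair_measure split: split_indicator)
    also have "\<dots> = (\<integral>\<^sup>+y. \<integral>\<^sup>+x. f (x, y) * indicator A y \<partial>M \<partial>N)"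
      by (subst MN.nn_integral_snd[symmetric]) (auto simp: case_prod_beta)
    also have "\<dots> = (\<integral>\<^sup>+x. indicator A x \<partial>N)"
      by (intro nn_integral_cong_AE, use N1 AE_space in eventually_elim)
         (auto simp: fM nn_integral_multc split: split_indicator)
    finally show "emeasure (distr P N snd) A = emeasure N A" by simp
  qed simp
  show "AE p in P. g (fst p) = h (snd p)"
    unfolding P_def by (subst AE_density) (auto simp: f_def)
qed

text \<open>A point is labelled by the first member of an enumerated dense set within \<delta>/2 of
  it. Two points with the same label are both that close to the same member.\<close>

lemma countable_small_cells:
  assumes "\<delta> > 0"
  obtains cell :: "'a::{metric_space, second_countable_topology} \<Rightarrow> nat"
  where "cell \<in> measurable borel (count_space UNIV)"
    "\<And>x y. cell x = cell y \<Longrightarrow> dist x y < \<delta>"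
proof -
  obtain D :: "'a set" where D: "countable D" "\<And>X. open X \<Longrightarrow> X \<noteq> {} \<Longrightarrow> \<exists>d\<in>D. d \<in> X"
    using countable_dense_exists by blast
  define cell where "cell x = (LEAST i. dist (from_nat_into D i) x < \<delta> / 2)" for x
  have near: "dist (from_nat_into D (cell x)) x < \<delta> / 2" for x
  proof -
    obtain d where "d \<in> D" "d \<in> ball x (\<delta> / 2)"
      using D(2)[of "ball x (\<delta> / 2)"] assms by auto
    then obtain i where "dist (from_nat_into D i) x < \<delta> / 2"
      using D(1) by (metis dist_commute from_nat_into_surj mem_ball)
    then show ?thesis unfolding cell_def by (rule LeastI)
  qed
  show ?thesis
  proof (rule that)
    show "cell \<in> measurable borel (count_space UNIV)"
      unfolding cell_def by measurable
    show "dist x y < \<delta>" if "cell x = cell y" for x y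
      using near[of x] near[of y] that by (metis dist_commute dist_triangle_half_r)
  qed
qed

section \<open>Measurability and integrability over restricted Borel spaces\<close>

lemma measurable_fst_restrict [measurable]:
  fixes \<Omega> :: "'a::topological_space set"
  shows "fst \<in> measurable (restrict_space borel (\<Omega> \<times> \<Omega>)) (restrict_space borel \<Omega>)"
  by (rule measurable_restrict_space3)
     (auto intro!: borel_measurable_continuous_onI continuous_on_fst continuous_on_snd continuous_on_id)

lemma measurable_snd_restrict [measurable]:
  fixes \<Omega> :: "'a::topological_space set"
  shows "snd \<in> measurable (restrict_space borel (\<Omega> \<times> \<Omega>)) (restrict_space borel \<Omega>)"
  by (rule measurable_restrict_space3)
     (auto intro!: borel_measurable_continuous_onI continuous_on_fst continuous_on_snd continuous_on_id)

lemma measurable_restrict_borelD: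
  "f \<in> measurable M (restrict_space borel \<Omega>) \<Longrightarrow> f \<in> borel_measurable M"
  "f \<in> measurable M (restrict_space borel \<Omega>) \<Longrightarrow> x \<in> space M \<Longrightarrow> f x \<in> \<Omega>"
  by (auto simp: measurable_restrict_space2_iff)

lemma measurable_Pair_restrict:
  fixes f g :: "'a \<Rightarrow> 'b::second_countable_topology"
  assumes "f \<in> measurable M (restrict_space borel \<Omega>)" "g \<in> measurable M (restrict_space borel \<Omega>)"
  shows "(\<lambda>x. (f x, g x)) \<in> measurable M (restrict_space borel (\<Omega> \<times> \<Omega>))"
  using assms by (auto simp: measurable_restrict_space2_iff intro!: borel_measurable_Pair)

lemma bounded_diff_norm_le:
  fixes \<Omega> :: "'a::real_normed_vector set"
  assumes "bounded \<Omega>"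
  obtains K where "K > 0" "\<And>x y. x \<in> \<Omega> \<Longrightarrow> y \<in> \<Omega> \<Longrightarrow> norm (x - y) \<le> K"
proof -
  obtain B where B: "B > 0" "\<And>x. x \<in> \<Omega> \<Longrightarrow> norm x \<le> B"
    using assms by (auto simp: bounded_pos)
  show ?thesis
  proof (rule that[of "2 * B"])
    show "norm (x - y) \<le> 2 * B" if "x \<in> \<Omega>" "y \<in> \<Omega>" for x y
      using norm_triangle_ineq4[of x y] B(2)[OF that(1)] B(2)[OF that(2)] by linarith
  qed (use B in simp)
qed

lemma integrable_sq_dist:
  fixes \<Omega> :: "'b::euclidean_space set"
  assumes "prob_space M" "bounded \<Omega>"
    and f: "f \<in> measurable M (restrict_space borel \<Omega>)"
    and g: "g \<in> measurable M (restrict_space borel \<Omega>)"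
  shows "integrable M (\<lambda>x. (norm (f x - g x))\<^sup>2)"
proof -
  interpret prob_space M by fact
  obtain K where K: "K > 0" "\<And>x y. x \<in> \<Omega> \<Longrightarrow> y \<in> \<Omega> \<Longrightarrow> norm (x - y) \<le> K"
    using bounded_diff_norm_le[OF assms(2)] by blast
  note [measurable] = measurable_restrict_borelD(1)[OF f] measurable_restrict_borelD(1)[OF g]
  show ?thesis
    by (rule integrable_const_bound[where B="K\<^sup>2"])
       (auto intro!: AE_I2 power_mono K measurable_restrict_borelD(2)[OF f]
          measurable_restrict_borelD(2)[OF g])
qed

section \<open>Couplings and the transport cost\<close>

lemma borel_probsD:
  assumes "\<mu> \<in> borel_probs \<Omega>"
  shows "prob_space \<mu>" "sets \<mu> = sets (restrict_space borel \<Omega>)" "space \<mu> = \<Omega>"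
  using assms sets_eq_imp_space_eq[of \<mu> "restrict_space borel \<Omega>"]
  by (auto simp: borel_probs_def space_restrict_space)

lemma couplingsD:
  assumes "\<pi> \<in> couplings \<Omega> \<alpha> \<beta>"
  shows "\<pi> \<in> borel_probs (\<Omega> \<times> \<Omega>)" "distr \<pi> (restrict_space borel \<Omega>) fst = \<alpha>"
    "distr \<pi> (restrict_space borel \<Omega>) snd = \<beta>"
  using assms by (auto simp: couplings_def push_forward_def)

text \<open>This is how every coupling below is produced: as the joint law of two maps on an
  auxiliary probability space.\<close>

lemma distr_Pair_in_couplings:
  fixes \<Omega> :: "'b::second_countable_topology set"
  assumes "prob_space M"
    and f: "f \<in> measurable M (restrict_space borel \<Omega>)"
    and g: "g \<in> measurable M (restrict_space borel \<Omega>)"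
  shows "distr M (restrict_space borel (\<Omega> \<times> \<Omega>)) (\<lambda>x. (f x, g x))
    \<in> couplings \<Omega> (push_forward \<Omega> f M) (push_forward \<Omega> g M)"
proof -
  interpret prob_space M by fact
  note p = measurable_Pair_restrict[OF f g]
  show ?thesis
    by (simp add: couplings_def borel_probs_def push_forward_def prob_space_distr[OF p]
        distr_distr[OF measurable_fst_restrict p] distr_distr[OF measurable_snd_restrict p] comp_def)
qed

text \<open>An infimum of reals lies below its members only if they are bounded below; here 0 is a
  bound, since the integrands are nonnegative.\<close>

lemma W2_cost_le:
  assumes "\<pi> \<in> couplings \<Omega> \<alpha> \<beta>"
  shows "W2_cost \<Omega> \<alpha> \<beta> \<le> (\<integral>z. (norm (fst z - snd z))\<^sup>2 \<partial>\<pi>)"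
  unfolding W2_cost_def using assms
  by (intro cINF_lower bdd_belowI[where m=0]) (auto intro: integral_nonneg_AE)

lemma integral_distr_Pair_sq_dist:
  fixes \<Omega> :: "'b::euclidean_space set"
  assumes "f \<in> measurable M (restrict_space borel \<Omega>)" "g \<in> measurable M (restrict_space borel \<Omega>)"
  shows "(\<integral>z. (norm (fst z - snd z))\<^sup>2 \<partial>distr M (restrict_space borel (\<Omega> \<times> \<Omega>)) (\<lambda>x. (f x, g x)))
    = (\<integral>x. (norm (f x - g x))\<^sup>2 \<partial>M)"
proof -
  have "(\<lambda>z::'b \<times> 'b. (norm (fst z - snd z))\<^sup>2) \<in> borel_measurable (restrict_space borel (\<Omega> \<times> \<Omega>))"
    by (intro measurable_restrict_space1 borel_measurable_continuous_onI continuous_intros)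
  from integral_distr[OF measurable_Pair_restrict[OF assms] this] show ?thesis by simp
qed

section \<open>Transport cost through self-couplings\<close>

text \<open>The easy half of the reformulation: if (x, z) has law \<gamma>, then the law of (x, T z)
  is an admissible coupling, and its cost is the right-hand side.\<close>

lemma W2_cost_push_forward_le:
  fixes \<Omega> :: "'a::euclidean_space set"
  assumes \<gamma>: "\<gamma> \<in> couplings \<Omega> \<rho> \<rho>"
    and T: "T \<in> measurable (restrict_space borel \<Omega>) (restrict_space borel \<Omega>)"
  shows "W2_cost \<Omega> \<rho> (push_forward \<Omega> T \<rho>) \<le> (\<integral>z. (norm (fst z - T (snd z)))\<^sup>2 \<partial>\<gamma>)"
proof -
  note g = couplingsD[OF \<gamma>] and b = borel_probsD[OF couplingsD(1)[OF \<gamma>]]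
  note [measurable_cong] = b(2)
  have f: "fst \<in> measurable \<gamma> (restrict_space borel \<Omega>)" by simp
  have s: "snd \<in> measurable \<gamma> (restrict_space borel \<Omega>)" by simp
  have Ts: "(\<lambda>z. T (snd z)) \<in> measurable \<gamma> (restrict_space borel \<Omega>)"
    using measurable_compose[OF s T] .
  have "push_forward \<Omega> T \<rho> = push_forward \<Omega> (\<lambda>z. T (snd z)) \<gamma>"
    unfolding g(3)[symmetric] push_forward_def by (simp add: distr_distr[OF T s] comp_def)
  with g(2) W2_cost_le[OF distr_Pair_in_couplings[OF b(1) f Ts]]
  show ?thesis
    by (simp add: integral_distr_Pair_sq_dist[OF f Ts] push_forward_def)
qed

text \<open>The converse half, up to \<epsilon>. Gluing \<pi> and \<rho> along the labels
  \<open>cell y\<close> and \<open>cell (T z)\<close> gives a law of triples ((x, y), z) in which y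
  and T z are close. Forgetting y leaves \<gamma>, and replacing y by T z changes the cost
  little.\<close>

lemma self_coupling_approx:
  fixes \<Omega> :: "'a::euclidean_space set"
  assumes "bounded \<Omega>" and \<rho>: "\<rho> \<in> borel_probs \<Omega>"
    and T: "T \<in> measurable (restrict_space borel \<Omega>) (restrict_space borel \<Omega>)"
    and \<pi>: "\<pi> \<in> couplings \<Omega> \<rho> (push_forward \<Omega> T \<rho>)"
    and "\<epsilon> > 0"
  obtains \<gamma> where "\<gamma> \<in> couplings \<Omega> \<rho> \<rho>"
    "(\<integral>z. (norm (fst z - T (snd z)))\<^sup>2 \<partial>\<gamma>) \<le> (\<integral>z. (norm (fst z - snd z))\<^sup>2 \<partial>\<pi>) + \<epsilon>"
proof -
  define B where "B = restrict_space borel \<Omega>"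
  note r = borel_probsD[OF \<rho>] and p = couplingsD[OF \<pi>, folded B_def]
  note b = borel_probsD[OF couplingsD(1)[OF \<pi>]]
  note [measurable_cong] = r(2)[folded B_def] b(2)
  note [measurable] = T[folded B_def] measurable_fst_restrict[of \<Omega>, folded B_def]
    measurable_snd_restrict[of \<Omega>, folded B_def]
  obtain K where K: "K > 0" "\<And>x y. x \<in> \<Omega> \<Longrightarrow> y \<in> \<Omega> \<Longrightarrow> norm (x - y) \<le> K"
    using bounded_diff_norm_le[OF assms(1)] by blast
  \<comment> \<open>Chosen so that 2 K \<delta> = \<epsilon>: a difference of squares of distances
    is their difference, at most \<delta>, times their sum, at most 2 K.\<close>
  define \<delta> where "\<delta> = \<epsilon> / (2 * K)"
  have \<delta>: "\<delta> > 0" using K \<open>\<epsilon> > 0\<close> by (simp add: \<delta>_def)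
  obtain cell :: "'a \<Rightarrow> nat" where cell: "cell \<in> measurable borel (count_space UNIV)"
    "\<And>x y. cell x = cell y \<Longrightarrow> dist x y < \<delta>"
    using countable_small_cells[OF \<delta>] by blast
  have [measurable]: "cell \<in> measurable B (count_space UNIV)"
    unfolding B_def by (rule measurable_restrict_space1[OF cell(1)])
  \<comment> \<open>The labels have the same law on both sides because y under \<pi> and T z under
    \<rho> both have law T\<sharp>\<rho>.\<close>
  have "distr \<pi> (count_space UNIV) (\<lambda>z. cell (snd z)) = distr (distr \<pi> B snd) (count_space UNIV) cell"
    by (subst distr_distr) (auto simp: comp_def)
  also have "\<dots> = distr \<rho> (count_space UNIV) (\<lambda>z. cell (T z))"
    unfolding p(3) push_forward_def B_def[symmetric]
    by (subst distr_distr) (auto simp: comp_def)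
  finally have "distr \<pi> (count_space UNIV) (\<lambda>z. cell (snd z)) = distr \<rho> (count_space UNIV) (\<lambda>z. cell (T z))" .
  from gluing_over_countable[OF b(1) r(1) _ _ this]
  obtain P where P: "sets P = sets (\<pi> \<Otimes>\<^sub>M \<rho>)" "distr P \<pi> fst = \<pi>" "distr P \<rho> snd = \<rho>"
    "AE q in P. cell (snd (fst q)) = cell (T (snd q))"
    by auto
  note [measurable_cong] = P(1)
  \<comment> \<open>The total mass of \<open>P\<close> is read off from its second marginal.\<close>
  have "prob_space (distr P \<rho> snd)" using r(1) P(3) by simp
  then have prob: "prob_space P"
    by (rule prob_space_distrD[rotated]) simp
  then interpret P: prob_space P .
  have x: "(\<lambda>q. fst (fst q)) \<in> measurable P B"
    and y: "(\<lambda>q. snd (fst q)) \<in> measurable P B"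
    and z: "snd \<in> measurable P B"
    and Tz: "(\<lambda>q. T (snd q)) \<in> measurable P B"
    by measurable
  note x = x[unfolded B_def] and y = y[unfolded B_def] and z = z[unfolded B_def]
    and Tz = Tz[unfolded B_def]
  define \<gamma> where "\<gamma> = distr P (restrict_space borel (\<Omega> \<times> \<Omega>)) (\<lambda>q. (fst (fst q), snd q))"
  have "push_forward \<Omega> (\<lambda>q. fst (fst q)) P = distr (distr P \<pi> fst) B fst"
    by (subst distr_distr) (auto simp: push_forward_def B_def comp_def)
  also have "\<dots> = \<rho>" using P(2) p(2) by simp
  finally have 1: "push_forward \<Omega> (\<lambda>q. fst (fst q)) P = \<rho>" .
  have "push_forward \<Omega> snd P = distr P \<rho> snd"
    using r(2) by (auto simp: push_forward_def intro!: distr_cong)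
  with P(3) have 2: "push_forward \<Omega> snd P = \<rho>" by simp
  have \<gamma>: "\<gamma> \<in> couplings \<Omega> \<rho> \<rho>"
    using distr_Pair_in_couplings[OF prob x z] unfolding 1 2 \<gamma>_def .
  have "(\<lambda>z. (norm (fst z - T (snd z)))\<^sup>2) \<in> borel_measurable (restrict_space borel (\<Omega> \<times> \<Omega>))"
    using measurable_restrict_borelD(1)[OF measurable_fst_restrict[of \<Omega>]]
      measurable_restrict_borelD(1)[OF measurable_compose[OF measurable_snd_restrict[of \<Omega>] T]]
    by measurable
  then have "(\<integral>z. (norm (fst z - T (snd z)))\<^sup>2 \<partial>\<gamma>) = (\<integral>q. (norm (fst (fst q) - T (snd q)))\<^sup>2 \<partial>P)"
    unfolding \<gamma>_def by (subst integral_distr[OF measurable_Pair_restrict[OF x z]]) auto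
  also have "\<dots> \<le> (\<integral>q. (norm (fst (fst q) - snd (fst q)))\<^sup>2 + \<epsilon> \<partial>P)"
  proof (rule integral_mono_AE)
    show "AE q in P. (norm (fst (fst q) - T (snd q)))\<^sup>2 \<le> (norm (fst (fst q) - snd (fst q)))\<^sup>2 + \<epsilon>"
      using P(4) AE_space
    proof eventually_elim
      case (elim q)
      define a b where "a = norm (fst (fst q) - T (snd q))" and "b = norm (fst (fst q) - snd (fst q))"
      have ab: "a \<le> K" "b \<le> K" "0 \<le> a" "0 \<le> b"
        unfolding a_def b_def using elim(2)
        by (auto intro!: K measurable_restrict_borelD(2)[OF x]
          measurable_restrict_borelD(2)[OF y] measurable_restrict_borelD(2)[OF Tz])
      have "a - b \<le> dist (snd (fst q)) (T (snd q))"
        unfolding a_def b_def dist_norm by norm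
      with cell(2)[OF elim(1)] have "a - b \<le> \<delta>" by simp
      have "a\<^sup>2 - b\<^sup>2 = (a - b) * (a + b)" by (simp add: power2_eq_square algebra_simps)
      also have "\<dots> \<le> \<delta> * (2 * K)"
        using ab \<delta> \<open>a - b \<le> \<delta>\<close> by (intro mult_mono) auto
      also have "\<dots> = \<epsilon>" using K by (simp add: \<delta>_def)
      finally show ?case by (simp add: a_def b_def)
    qed
  qed (use integrable_sq_dist[OF prob assms(1) x Tz] integrable_sq_dist[OF prob assms(1) x y] in auto)
  also have "\<dots> = (\<integral>q. (norm (fst (fst q) - snd (fst q)))\<^sup>2 \<partial>P) + \<epsilon>"
    using integrable_sq_dist[OF prob assms(1) x y] by (simp add: P.prob_space)
  also have "(\<integral>q. (norm (fst (fst q) - snd (fst q)))\<^sup>2 \<partial>P) = (\<integral>z. (norm (fst z - snd z))\<^sup>2 \<partial>distr P \<pi> fst)"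
    using measurable_restrict_borelD(1)[OF measurable_fst_restrict[of \<Omega>]]
      measurable_restrict_borelD(1)[OF measurable_snd_restrict[of \<Omega>]]
    by (subst integral_distr) auto
  finally show ?thesis using \<gamma> that P(2) by simp
qed

section \<open>Convexity of the Monge gap\<close>

text \<open>For any vector v, the squared norm of v cancels in the difference of the squared
  distances from x and z to v. Only a constant and the linear term -2 \<open>inner (x - z) v\<close>
  remain, and the weights \<open>1 - t\<close> and \<open>t\<close> sum to 1.\<close>

lemma sq_dist_diff_affine:
  fixes x z a b :: "'a::real_inner"
  shows "(norm (x - ((1 - t) *\<^sub>R a + t *\<^sub>R b)))\<^sup>2 - (norm (z - ((1 - t) *\<^sub>R a + t *\<^sub>R b)))\<^sup>2
    = (1 - t) * ((norm (x - a))\<^sup>2 - (norm (z - a))\<^sup>2) + t * ((norm (x - b))\<^sup>2 - (norm (z - b))\<^sup>2)"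
  unfolding power2_norm_eq_inner
  by (simp add: inner_diff_left inner_diff_right inner_add_left inner_add_right inner_commute algebra_simps)

theorem corollary3p5:
  fixes \<Omega> :: "(real ^ 'd) set"
    and \<rho> :: "(real ^ 'd) measure"
    and T\<^sub>0 T\<^sub>1 :: "real ^ 'd \<Rightarrow> real ^ 'd"
    and t :: real
  assumes "compact \<Omega>"
    and "\<rho> \<in> borel_probs \<Omega>"
    and "continuous_on \<Omega> T\<^sub>0" and "T\<^sub>0 ` \<Omega> \<subseteq> \<Omega>"
    and "continuous_on \<Omega> T\<^sub>1" and "T\<^sub>1 ` \<Omega> \<subseteq> \<Omega>"
    and "t \<in> {0..1}"
    and "(\<lambda>x. (1 - t) *\<^sub>R T\<^sub>0 x + t *\<^sub>R T\<^sub>1 x) ` \<Omega> \<subseteq> \<Omega>"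
  shows "monge_gap \<Omega> \<rho> (\<lambda>x. (1 - t) *\<^sub>R T\<^sub>0 x + t *\<^sub>R T\<^sub>1 x)
           \<le> (1 - t) * monge_gap \<Omega> \<rho> T\<^sub>0 + t * monge_gap \<Omega> \<rho> T\<^sub>1"
proof -
  define T where "T = (\<lambda>x. (1 - t) *\<^sub>R T\<^sub>0 x + t *\<^sub>R T\<^sub>1 x)"
  define B where "B = restrict_space borel \<Omega>"
  define I where "I S = (\<integral>x. (norm (x - S x))\<^sup>2 \<partial>\<rho>)" for S :: "real ^ 'd \<Rightarrow> real ^ 'd"
  define W where "W S = W2_cost \<Omega> \<rho> (push_forward \<Omega> S \<rho>)" for S
  have gap: "monge_gap \<Omega> \<rho> S = I S - W S" for S
    by (simp add: monge_gap_def I_def W_def)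
  have bdd: "bounded \<Omega>" using assms(1) by (rule compact_imp_bounded)
  note r = borel_probsD[OF assms(2)]
  have meas: "S \<in> measurable B B" if "continuous_on \<Omega> S" "S ` \<Omega> \<subseteq> \<Omega>" for S
    unfolding B_def using that
    by (auto simp: measurable_restrict_space2_iff space_restrict_space
        intro: borel_measurable_continuous_on_restrict)
  have T0: "T\<^sub>0 \<in> measurable B B" and T1: "T\<^sub>1 \<in> measurable B B"
    using meas assms by auto
  have T: "T \<in> measurable B B"
    using assms by (intro meas) (auto simp: T_def intro!: continuous_intros)
  \<comment> \<open>The claim rearranged as a lower bound for \<open>W T\<close>. An infimum is
    bounded below by bounding every competitor \<pi>.\<close>
  have "(1 - t) * (W T\<^sub>0 - I T\<^sub>0) + t * (W T\<^sub>1 - I T\<^sub>1) + I T \<le> W T"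
    unfolding W_def[of T] W2_cost_def
  proof (rule cINF_greatest)
    \<comment> \<open>The infimum rule needs a competitor to exist; the law of (x, T x) under \<rho>
      is one.\<close>
    have "(\<lambda>x. x) \<in> measurable \<rho> B" "T \<in> measurable \<rho> B"
      unfolding measurable_cong_sets[OF r(2)[folded B_def] refl] using T by simp_all
    from distr_Pair_in_couplings[OF r(1) this[unfolded B_def]]
    show "couplings \<Omega> \<rho> (push_forward \<Omega> T \<rho>) \<noteq> {}"
      unfolding push_forward_def distr_id2[OF r(2)[symmetric]] by blast
  next
    fix \<pi> assume \<pi>: "\<pi> \<in> couplings \<Omega> \<rho> (push_forward \<Omega> T \<rho>)"
    show "(1 - t) * (W T\<^sub>0 - I T\<^sub>0) + t * (W T\<^sub>1 - I T\<^sub>1) + I T \<le> (\<integral>z. (norm (fst z - snd z))\<^sup>2 \<partial>\<pi>)"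
    \<comment> \<open>The slack \<epsilon> absorbs the error of the approximate gluing.\<close>
    proof (rule field_le_epsilon)
      fix \<epsilon> :: real assume "\<epsilon> > 0"
      obtain \<gamma> where \<gamma>: "\<gamma> \<in> couplings \<Omega> \<rho> \<rho>"
        and le: "(\<integral>z. (norm (fst z - T (snd z)))\<^sup>2 \<partial>\<gamma>) \<le> (\<integral>z. (norm (fst z - snd z))\<^sup>2 \<partial>\<pi>) + \<epsilon>"
        using self_coupling_approx[OF bdd assms(2) T[unfolded B_def] \<pi> \<open>\<epsilon> > 0\<close>] by blast
      note g = couplingsD[OF \<gamma>, folded B_def] and b = borel_probsD[OF couplingsD(1)[OF \<gamma>]]
      define C where "C S = (\<integral>z. (norm (fst z - S (snd z)))\<^sup>2 \<partial>\<gamma>)" for S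
      have fst: "fst \<in> measurable \<gamma> B" and snd: "snd \<in> measurable \<gamma> B"
        unfolding B_def measurable_cong_sets[OF b(2) refl] by simp_all
      have int1: "integrable \<gamma> (\<lambda>z. (norm (fst z - S (snd z)))\<^sup>2)"
        and int2: "integrable \<gamma> (\<lambda>z. (norm (snd z - S (snd z)))\<^sup>2)" if "S \<in> measurable B B" for S
        using integrable_sq_dist[OF b(1) bdd] fst snd measurable_compose[OF snd that]
        unfolding B_def by blast+
      \<comment> \<open>The second marginal of \<gamma> is \<rho>, so \<open>I S\<close> becomes an
        integral over \<gamma> in the variable z. It can then be subtracted from \<open>C S\<close>
        under one integral sign.\<close>
      have I: "I S = (\<integral>z. (norm (snd z - S (snd z)))\<^sup>2 \<partial>\<gamma>)" if "S \<in> measurable B B" for S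
      proof -
        have [measurable]: "S \<in> borel_measurable B" "(\<lambda>x. x) \<in> borel_measurable B"
          using that by (auto simp: B_def measurable_restrict_borelD(1) intro: measurable_restrict_space1)
        have "(\<lambda>x. (norm (x - S x))\<^sup>2) \<in> borel_measurable B" by measurable
        then show ?thesis
          unfolding I_def by (subst g(3)[symmetric]) (rule integral_distr[OF snd])
      qed
      have diff: "C S - I S = (\<integral>z. (norm (fst z - S (snd z)))\<^sup>2 - (norm (snd z - S (snd z)))\<^sup>2 \<partial>\<gamma>)"
        if "S \<in> measurable B B" for S
        unfolding C_def I[OF that] using int1[OF that] int2[OF that] by simp
      \<comment> \<open>With \<gamma> fixed, \<open>C S - I S\<close> is affine in \<open>S\<close>,
        so equality holds here.\<close>
      have "C T - I T = (1 - t) * (C T\<^sub>0 - I T\<^sub>0) + t * (C T\<^sub>1 - I T\<^sub>1)"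
        unfolding diff[OF T] diff[OF T0] diff[OF T1]
        unfolding T_def sq_dist_diff_affine
        using int1[OF T0] int2[OF T0] int1[OF T1] int2[OF T1] by simp
      \<comment> \<open>The \<gamma> built from \<open>T\<close> is also a competitor for
        \<open>T\<^sub>0\<close> and \<open>T\<^sub>1\<close>, possibly a suboptimal one. This is
        the only source of inequality besides \<epsilon>; both weights are nonnegative as t lies in
        [0,1].\<close>
      moreover have "(1 - t) * (W T\<^sub>0 - I T\<^sub>0) \<le> (1 - t) * (C T\<^sub>0 - I T\<^sub>0)"
        "t * (W T\<^sub>1 - I T\<^sub>1) \<le> t * (C T\<^sub>1 - I T\<^sub>1)"
        using assms(7) W2_cost_push_forward_le[OF \<gamma> T0[unfolded B_def]]
          W2_cost_push_forward_le[OF \<gamma> T1[unfolded B_def]]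
        by (auto simp: W_def C_def intro!: mult_left_mono)
      ultimately show "(1 - t) * (W T\<^sub>0 - I T\<^sub>0) + t * (W T\<^sub>1 - I T\<^sub>1) + I T
          \<le> (\<integral>z. (norm (fst z - snd z))\<^sup>2 \<partial>\<pi>) + \<epsilon>"
        using le unfolding C_def[symmetric] by linarith
    qed
  qed
  then show ?thesis
    unfolding T_def[symmetric] gap by (simp add: algebra_simps)
qed

end
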